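(* Let $0\le\varepsilon\le 1$ and define the subspace $$R_r(U_r;\mu):=\mathrm{span}\{\mathbf{R}_U^{-1}\mathbf{r}(\mathbf{x};\mu):\mathbf{x}\in U_r\}\subset U.$$ If $\mathbf{\Theta}$ is a $U\to\ell_2$ $\varepsilon$-subspace embedding for $R_r(U_r;\mu)$, then $$\sqrt{1-\varepsilon}\,\zeta_r(\mu)\le\zeta^{\mathbf{\Theta}}_r(\mu)\le\sqrt{1+\varepsilon}\,\zeta_r(\mu)\quad\text{and}\quad \sqrt{1-\varepsilon}\,\iota_r(\mu)\le\iota^{\mathbf{\Theta}}_r(\mu)\le\sqrt{1+\varepsilon}\,\iota_r(\mu).$$
   Context: Let $\mathbb{K}=\mathbb{R}$ or $\mathbb{C}$, $U=U'=\mathbb{K}^n$, $\langle\cdot,\cdot\rangle$ and $\|\cdot\|$ the canonical $\ell_2$-inner product and norm. $\mathbf{R}_U\in\mathbb{K}^{n\times n}$ is symmetric (Hermitian if $\mathbb{K}=\mathbb{C}$) positive definite. $U$ is equipped with $\langle\cdot,\cdot\rangle_U=\langle\mathbf{R}_U\cdot,\cdot\rangle$ and $U'$ with $\langle\cdot,\cdot\rangle_{U'}=\langle\cdot,\mathbf{R}_U^{-1}\cdot\rangle$; $\|\cdot\|_U,\|\cdot\|_{U'}$ are the associated norms. For $\mathbf{\Theta}\in\mathbb{K}^{k\times n}$ ($k\le n$), define the semi-inner product $\langle\mathbf{x},\mathbf{y}\rangle^{\mathbf{\Theta}}_U=\langle\mathbf{\Theta}\mathbf{x},\mathbf{\Theta}\mathbf{y}\rangle$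 on $U$ and the semi-norm $\|\mathbf{y}\|^{\mathbf{\Theta}}_{U'}=\|\mathbf{\Theta}\mathbf{R}_U^{-1}\mathbf{y}\|$ on $U'$. $\mathbf{\Theta}$ is a $U\to\ell_2$ $\varepsilon$-subspace embedding for a subspace $V\subset U$ if $|\langle\mathbf{x},\mathbf{y}\rangle_U-\langle\mathbf{x},\mathbf{y}\rangle^{\mathbf{\Theta}}_U|\le\varepsilon\|\mathbf{x}\|_U\|\mathbf{y}\|_U$ for all $\mathbf{x},\mathbf{y}\in V$. For a fixed parameter value $\mu$, $\mathbf{A}(\mu)\in\mathbb{K}^{n\times n}$ (a linear operator $U\to U'$), $\mathbf{b}(\mu)\in U'$, and $\mathbf{u}(\mu)\in U$ satisfies $\mathbf{A}(\mu)\mathbf{u}(\mu)=\mathbf{b}(\mu)$. The residual is $\mathbf{r}(\mathbf{x};\mu)=\mathbf{b}(\mu)-\mathbf{A}(\mu)\mathbf{x}$. $U_r\subset U$ is a linear subspace with $\mathrm{span}\{\mathbf{u}(\mu)\}+U_r\neq\{\mathbf{0}\}$. With $\mathbf{x}$ ranging over $(\mathrm{span}\{\mathbf{u}(\mu)\}+U_r)\setminus\{\mathbf{0}\}$, define $$\zeta_r(\mu)=\min_{\mathbf{x}}\frac{\|\mathbf{A}(\mu)\mathbf{x}\|_{U'}}{\|\mathbf{x}\|_U},\quad \iota_r(\mu)=\max_{\mathbf{x}}\frac{\|\mathbf{A}(\mu)\mathbf{x}\|_{U'}}{\|\mathbf{x}\|_U},\quad \zeta^{\mathbf{\Theta}}_r(\mu)=\min_{\mathbf{x}}\frac{\|\mathbf{A}(\mu)\mathbf{x}\|^{\mathbf{\Theta}}_{U'}}{\|\mathbf{x}\|_U},\quad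 \iota^{\mathbf{\Theta}}_r(\mu)=\max_{\mathbf{x}}\frac{\|\mathbf{A}(\mu)\mathbf{x}\|^{\mathbf{\Theta}}_{U'}}{\|\mathbf{x}\|_U}.$$ *)

theory Defs
  imports "HOL-Analysis.Analysis"
begin

text \<open>
  The scalar field. Every model of this class is, as a normed field with conjugation, the reals
  or the complex numbers: \<open>conjg x = - x\<close> implies \<open>x\<^sup>2 = - (norm x)\<^sup>2\<close>, so either \<open>conjg\<close> is the
  identity and every scalar is real, or there is an imaginary unit, and any two scalars with
  \<open>conjg x = - x\<close> have a real product, so that every scalar is \<open>a + b i\<close> with \<open>a, b\<close> real.
\<close>

class real_or_complex = real_normed_field + euclidean_space +
  fixes conjg :: "'a \<Rightarrow> 'a"
  assumes conjg_add: "conjg (x + y) = conjg x + conjg y"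
    and conjg_mult: "conjg (x * y) = conjg x * conjg y"
    and conjg_conjg: "conjg (conjg x) = x"
    and mult_conjg: "x * conjg x = (norm x)\<^sup>2 *\<^sub>R 1"
    and add_conjg: "\<exists>r. x + conjg x = r *\<^sub>R 1"

instantiation real :: real_or_complex
begin

definition conjg_real :: "real \<Rightarrow> real" where "conjg_real x = x"

instance
  by standard (simp_all add: conjg_real_def power2_eq_square)

end

instantiation complex :: real_or_complex
begin

definition conjg_complex :: "complex \<Rightarrow> complex" where "conjg_complex = cnj"

instance
proof
  fix x :: complex
  show "x * conjg x = (norm x)\<^sup>2 *\<^sub>R 1"
    by (metis complex_norm_square conjg_complex_def of_real_def)
  show "\<exists>r. x + conjg x = r *\<^sub>R 1"
    by (metis complex_add_cnj conjg_complex_def of_real_def)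
qed (simp_all add: conjg_complex_def)

end

text \<open>
  The canonical inner product, linear in the first argument. The class operation
  \<open>inner\<close> is only its real part; the library's \<open>norm\<close> on \<open>'a ^ 'n\<close> is the associated norm.
\<close>

definition cinner_l2 :: "'a::real_or_complex ^ 'n \<Rightarrow> 'a ^ 'n \<Rightarrow> 'a" where
  "cinner_l2 x y = (\<Sum>i\<in>UNIV. x $ i * conjg (y $ i))"

lemma cinner_l2_self: "cinner_l2 x x = of_real ((norm x)\<^sup>2)"
  by (simp add: cinner_l2_def mult_conjg norm_vec_def L2_set_def sum_nonneg scaleR_conv_of_real)

definition hermitian_pos_def :: "'a::real_or_complex ^ 'n ^ 'n \<Rightarrow> bool" where
  "hermitian_pos_def R \<longleftrightarrow>
     (\<forall>i j. R $ i $ j = conjg (R $ j $ i)) \<and>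
     (\<forall>x. x \<noteq> 0 \<longrightarrow> (\<exists>c::real. 0 < c \<and> cinner_l2 (R *v x) x = of_real c))"

definition inner_U :: "'a::real_or_complex ^ 'n ^ 'n \<Rightarrow> 'a ^ 'n \<Rightarrow> 'a ^ 'n \<Rightarrow> 'a" where
  "inner_U R x y = cinner_l2 (R *v x) y"

definition inner_U' :: "'a::real_or_complex ^ 'n ^ 'n \<Rightarrow> 'a ^ 'n \<Rightarrow> 'a ^ 'n \<Rightarrow> 'a" where
  "inner_U' R x y = cinner_l2 x (matrix_inv R *v y)"

text \<open>
  For Hermitian positive definite \<open>R\<close> the scalars \<open>inner_U R x x\<close> and \<open>inner_U' R y y\<close> are
  nonnegative reals; taking \<open>norm\<close> of them only changes their type from \<open>'a\<close> to \<open>real\<close>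
  (see \<open>inner_U_self\<close> and \<open>inner_U'_self\<close> below).
\<close>

definition norm_U :: "'a::real_or_complex ^ 'n ^ 'n \<Rightarrow> 'a ^ 'n \<Rightarrow> real" where
  "norm_U R x = sqrt (norm (inner_U R x x))"

definition norm_U' :: "'a::real_or_complex ^ 'n ^ 'n \<Rightarrow> 'a ^ 'n \<Rightarrow> real" where
  "norm_U' R y = sqrt (norm (inner_U' R y y))"

lemma inner_U_self:
  assumes "hermitian_pos_def R"
  shows "inner_U R x x = of_real ((norm_U R x)\<^sup>2)"
proof (cases "x = 0")
  case True
  then show ?thesis by (simp add: norm_U_def inner_U_def cinner_l2_def)
next
  case False
  then obtain c :: real where "0 < c" "cinner_l2 (R *v x) x = of_real c"
    using assms unfolding hermitian_pos_def_def by blast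
  then show ?thesis by (simp add: norm_U_def inner_U_def)
qed

lemma hermitian_pos_def_invertible:
  assumes "hermitian_pos_def R"
  shows "invertible R"
proof -
  have "x = 0" if "R *v x = 0" for x
  proof (rule ccontr)
    assume "x \<noteq> 0"
    then obtain c :: real where "0 < c" "cinner_l2 (R *v x) x = of_real c"
      using assms unfolding hermitian_pos_def_def by blast
    with that show False by (simp add: cinner_l2_def)
  qed
  then show ?thesis
    by (metis invertible_left_inverse matrix_left_invertible_ker)
qed

lemma inner_U'_eq_inner_U:
  assumes "hermitian_pos_def R"
  shows "inner_U' R x y = inner_U R (matrix_inv R *v x) (matrix_inv R *v y)"
proof -
  have "R ** matrix_inv R = mat 1"
    using someI_ex[OF hermitian_pos_def_invertible[OF assms, unfolded invertible_def]]
    by (simp add: matrix_inv_def)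
  then show ?thesis
    by (simp add: inner_U'_def inner_U_def matrix_vector_mul_assoc)
qed

lemma inner_U'_self:
  assumes "hermitian_pos_def R"
  shows "inner_U' R y y = of_real ((norm_U' R y)\<^sup>2)"
  using inner_U_self[OF assms, of "matrix_inv R *v y"]
  by (simp add: norm_U'_def norm_U_def inner_U'_eq_inner_U[OF assms])

definition sketched_inner_U :: "'a::real_or_complex ^ 'n ^ 'k \<Rightarrow> 'a ^ 'n \<Rightarrow> 'a ^ 'n \<Rightarrow> 'a" where
  "sketched_inner_U \<Theta> x y = cinner_l2 (\<Theta> *v x) (\<Theta> *v y)"

definition sketched_norm_U' ::
  "'a::real_or_complex ^ 'n ^ 'n \<Rightarrow> 'a ^ 'n ^ 'k \<Rightarrow> 'a ^ 'n \<Rightarrow> real" where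
  "sketched_norm_U' R \<Theta> y = norm (\<Theta> *v (matrix_inv R *v y))"

definition subspace_embedding ::
  "'a::real_or_complex ^ 'n ^ 'n \<Rightarrow> 'a ^ 'n ^ 'k \<Rightarrow> real \<Rightarrow> ('a ^ 'n) set \<Rightarrow> bool" where
  "subspace_embedding R \<Theta> \<epsilon> V \<longleftrightarrow>
     (\<forall>x\<in>V. \<forall>y\<in>V. norm (inner_U R x y - sketched_inner_U \<Theta> x y) \<le> \<epsilon> * norm_U R x * norm_U R y)"

definition residual :: "'a::real_or_complex ^ 'n ^ 'n \<Rightarrow> 'a ^ 'n \<Rightarrow> 'a ^ 'n \<Rightarrow> 'a ^ 'n" where
  "residual A b x = b - A *v x"

definition residual_space ::
  "'a::real_or_complex ^ 'n ^ 'n \<Rightarrow> 'a ^ 'n ^ 'n \<Rightarrow> 'a ^ 'n \<Rightarrow> ('a ^ 'n) set \<Rightarrow> ('a ^ 'n) set" where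
  "residual_space R A b Ur = vec.span {matrix_inv R *v residual A b x | x. x \<in> Ur}"

definition augmented_space :: "'a::real_or_complex ^ 'n \<Rightarrow> ('a ^ 'n) set \<Rightarrow> ('a ^ 'n) set" where
  "augmented_space u Ur = {v + w | v w. v \<in> vec.span {u} \<and> w \<in> Ur}"

text \<open>
  \<open>LEAST\<close> and \<open>GREATEST\<close> denote an attained minimum and maximum (rather than an infimum and
  supremum).
\<close>

definition zeta ::
  "'a::real_or_complex ^ 'n ^ 'n \<Rightarrow> 'a ^ 'n ^ 'n \<Rightarrow> 'a ^ 'n \<Rightarrow> ('a ^ 'n) set \<Rightarrow> real" where
  "zeta R A u Ur =
     (LEAST t. t \<in> {norm_U' R (A *v x) / norm_U R x | x. x \<in> augmented_space u Ur - {0}})"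

definition iota ::
  "'a::real_or_complex ^ 'n ^ 'n \<Rightarrow> 'a ^ 'n ^ 'n \<Rightarrow> 'a ^ 'n \<Rightarrow> ('a ^ 'n) set \<Rightarrow> real" where
  "iota R A u Ur =
     (GREATEST t. t \<in> {norm_U' R (A *v x) / norm_U R x | x. x \<in> augmented_space u Ur - {0}})"

definition sketched_zeta ::
  "'a::real_or_complex ^ 'n ^ 'n \<Rightarrow> 'a ^ 'n ^ 'k \<Rightarrow> 'a ^ 'n ^ 'n \<Rightarrow> 'a ^ 'n \<Rightarrow> ('a ^ 'n) set \<Rightarrow> real" where
  "sketched_zeta R \<Theta> A u Ur =
     (LEAST t. t \<in> {sketched_norm_U' R \<Theta> (A *v x) / norm_U R x | x. x \<in> augmented_space u Ur - {0}})"

definition sketched_iota ::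
  "'a::real_or_complex ^ 'n ^ 'n \<Rightarrow> 'a ^ 'n ^ 'k \<Rightarrow> 'a ^ 'n ^ 'n \<Rightarrow> 'a ^ 'n \<Rightarrow> ('a ^ 'n) set \<Rightarrow> real" where
  "sketched_iota R \<Theta> A u Ur =
     (GREATEST t. t \<in> {sketched_norm_U' R \<Theta> (A *v x) / norm_U R x | x. x \<in> augmented_space u Ur - {0}})"

end

theory Submission
  imports Defs
begin

text \<open>
  For \<open>x = c u + w\<close> the vector \<open>R\<^sup>-\<^sup>1 A x\<close> is a combination of the Riesz representers of the
  residuals at \<open>0\<close> and \<open>w\<close>, so the embedding property distorts \<open>\<parallel>A x\<parallel>\<close> by a factor between
  \<open>sqrt (1 - \<epsilon>)\<close> and \<open>sqrt (1 + \<epsilon>)\<close>. The extrema exist because the quotients are continuous and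
  invariant under scaling, hence determined on the compact unit sphere of the augmented space.
\<close>

text \<open>The class axioms leave the action on real scalars implicit, but
  \<open>mult_conjg\<close> forces it: cancel \<open>r\<close> in r * conjg r = r^2. Additivity
  settles r = 0.\<close>

lemma conjg_of_real: "conjg (of_real r :: 'a::real_or_complex) = of_real r"
proof (cases "r = 0")
  case True
  have "conjg (0::'a) = conjg 0 + conjg 0"
    using conjg_add[of "0::'a" 0] by simp
  then show ?thesis using True by simp
next
  case False
  have "of_real r * conjg (of_real r :: 'a) = of_real r * of_real r"
    by (simp add: mult_conjg of_real_def power2_eq_square)
  then show ?thesis using False by simp
qed

lemma conjg_scaleR: "conjg (r *\<^sub>R x) = r *\<^sub>R conjg (x :: 'a::real_or_complex)"
  by (simp add: scaleR_conv_of_real conjg_mult conjg_of_real)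

text \<open>Continuity is not a class axiom. It follows from real linearity, because the scalar
  field is finite-dimensional over the reals.\<close>

lemma continuous_on_conjg [continuous_intros]:
  fixes f :: "'b::topological_space \<Rightarrow> 'a::real_or_complex"
  assumes "continuous_on S f"
  shows "continuous_on S (\<lambda>x. conjg (f x))"
proof -
  have "linear (conjg :: 'a \<Rightarrow> 'a)"
    by (rule linearI) (simp_all add: conjg_add conjg_scaleR)
  then have "bounded_linear (conjg :: 'a \<Rightarrow> 'a)"
    by (simp add: linear_conv_bounded_linear)
  then show ?thesis
    using assms by (rule bounded_linear.continuous_on)
qed

lemma matrix_vector_mult_scaleR_right:
  fixes M :: "'a::real_or_complex ^ 'n ^ 'm"
  shows "M *v (c *\<^sub>R x) = c *\<^sub>R (M *v x)"
  by (simp add: vec_eq_iff matrix_vector_mult_def scaleR_sum_right)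

lemma continuous_on_matrix_vector_mult [continuous_intros]:
  fixes M :: "'a::real_or_complex ^ 'n ^ 'm"
  assumes "continuous_on S f"
  shows "continuous_on S (\<lambda>x. M *v f x)"
  unfolding matrix_vector_mult_def
  by (intro continuous_intros assms)

lemma norm_U_scaleR: "norm_U R (c *\<^sub>R x) = \<bar>c\<bar> * norm_U R x"
proof -
  have "inner_U R (c *\<^sub>R x) (c *\<^sub>R x) = (c * c) *\<^sub>R inner_U R x x"
    by (simp add: inner_U_def cinner_l2_def matrix_vector_mult_scaleR_right conjg_scaleR
        scaleR_sum_right)
  then show ?thesis
    by (simp add: norm_U_def real_sqrt_mult)
qed

lemma continuous_on_norm_U [continuous_intros]:
  assumes "continuous_on S f"
  shows "continuous_on S (\<lambda>x. norm_U R (f x))"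
  unfolding norm_U_def inner_U_def cinner_l2_def
  by (intro continuous_intros assms)

lemma norm_U_pos:
  assumes "hermitian_pos_def R" "x \<noteq> 0"
  shows "0 < norm_U R x"
  using assms by (auto simp: hermitian_pos_def_def norm_U_def inner_U_def)

lemma norm_U'_eq_norm_U:
  assumes "hermitian_pos_def R"
  shows "norm_U' R y = norm_U R (matrix_inv R *v y)"
  by (simp add: norm_U'_def norm_U_def inner_U'_eq_inner_U[OF assms])

lemma subspace_augmented_space:
  assumes "vec.subspace Ur"
  shows "vec.subspace (augmented_space u Ur)"
  unfolding augmented_space_def
  using vec.subspace_sums[OF vec.subspace_span assms] by auto

text \<open>Subspaces over the scalar field \<open>'a\<close> are also real subspaces, since real
  scalars act through \<open>of_real\<close>. The compactness argument below uses only the real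
  structure.\<close>

lemma vec_subspace_imp_subspace:
  fixes V :: "('a::real_or_complex ^ 'n) set"
  assumes "vec.subspace V"
  shows "subspace V"
proof -
  have "c *\<^sub>R x = of_real c *s x" for c and x :: "'a ^ 'n"
    unfolding vec_eq_iff vector_scaleR_component vector_smult_component
    by (simp add: scaleR_conv_of_real)
  then show ?thesis
    using assms by (simp add: subspace_def vec.subspace_def)
qed

lemma matrix_inv_image_in_residual_space:
  assumes "A *v u = b" "vec.subspace Ur" "x \<in> augmented_space u Ur"
  shows "matrix_inv R *v (A *v x) \<in> residual_space R A b Ur"
proof -
  let ?g = "\<lambda>z. matrix_inv R *v residual A b z"
  obtain c w where x: "x = c *s u + w" and w: "w \<in> Ur"
    using assms(3) by (auto simp: augmented_space_def vec.span_singleton)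
  have g: "?g z \<in> residual_space R A b Ur" if "z \<in> Ur" for z
    using that unfolding residual_space_def by (intro vec.span_base) auto
  \<comment> \<open>With r the residual, A u = b = r(0) and A w = r(0) - r(w). The point 0 is
    available because \<open>Ur\<close> is a subspace.\<close>
  have "matrix_inv R *v (A *v x) = c *s ?g 0 + (?g 0 - ?g w)"
    by (simp add: x assms(1) residual_def vec.add vec.diff vec.scale)
  also have "\<dots> \<in> residual_space R A b Ur"
    using g[OF vec.subspace_0[OF assms(2)]] g[OF w] unfolding residual_space_def
    by (intro vec.span_add vec.span_diff vec.span_scale)
  finally show ?thesis .
qed

text \<open>Take both arguments of the embedding inequality equal to \<open>y\<close>: the squared
  norms then differ by at most \<epsilon> times the squared U-norm, and square roots give both
  bounds.\<close>

lemma subspace_embedding_norm_bounds: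
  assumes "hermitian_pos_def R" "subspace_embedding R \<Theta> \<epsilon> V" "y \<in> V"
    and "0 \<le> \<epsilon>" "\<epsilon> \<le> 1"
  shows "sqrt (1 - \<epsilon>) * norm_U R y \<le> norm (\<Theta> *v y)"
    and "norm (\<Theta> *v y) \<le> sqrt (1 + \<epsilon>) * norm_U R y"
proof -
  \<comment> \<open>Writing the norm as a root lets \<open>real_sqrt_mult\<close> match the product
    of roots in the goal with the root of a product obtained below.\<close>
  have N: "norm_U R y = sqrt ((norm_U R y)\<^sup>2)"
    by (simp add: norm_U_def)
  have "inner_U R y y - sketched_inner_U \<Theta> y y
      = of_real ((norm_U R y)\<^sup>2 - (norm (\<Theta> *v y))\<^sup>2)"
    by (simp add: inner_U_self[OF assms(1)] sketched_inner_U_def cinner_l2_self)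
  moreover have "norm (inner_U R y y - sketched_inner_U \<Theta> y y) \<le> \<epsilon> * norm_U R y * norm_U R y"
    using assms(2,3) by (auto simp: subspace_embedding_def)
  ultimately have *: "\<bar>(norm_U R y)\<^sup>2 - (norm (\<Theta> *v y))\<^sup>2\<bar> \<le> \<epsilon> * (norm_U R y)\<^sup>2"
    by (simp only: norm_of_real power2_eq_square mult.assoc)
  have "sqrt ((1 - \<epsilon>) * (norm_U R y)\<^sup>2) \<le> norm (\<Theta> *v y)"
    using * by (intro real_le_lsqrt) (auto simp: algebra_simps)
  then show "sqrt (1 - \<epsilon>) * norm_U R y \<le> norm (\<Theta> *v y)"
    by (subst N) (simp only: real_sqrt_mult)
  have "norm (\<Theta> *v y) \<le> sqrt ((1 + \<epsilon>) * (norm_U R y)\<^sup>2)"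
    using * by (intro real_le_rsqrt) (auto simp: algebra_simps)
  then show "norm (\<Theta> *v y) \<le> sqrt (1 + \<epsilon>) * norm_U R y"
    by (subst N) (simp only: real_sqrt_mult)
qed

text \<open>The hypotheses are ones that both the exact dual norm of A x and its sketched semi-norm
  satisfy as \<open>p\<close>, so one statement yields the extrema of both quotients.\<close>

lemma quotient_attains_extrema:
  fixes V :: "'b::euclidean_space set" and p q :: "'b \<Rightarrow> real"
  assumes "subspace V" "V \<noteq> {0}" "continuous_on UNIV p" "continuous_on UNIV q"
    and "\<And>c x. p (c *\<^sub>R x) = \<bar>c\<bar> * p x" "\<And>c x. q (c *\<^sub>R x) = \<bar>c\<bar> * q x"
    and "\<And>x. x \<noteq> 0 \<Longrightarrow> 0 < q x"
  shows "\<exists>x\<in>V - {0}. \<forall>y\<in>V - {0}. p x / q x \<le> p y / q y"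
    and "\<exists>x\<in>V - {0}. \<forall>y\<in>V - {0}. p y / q y \<le> p x / q x"
proof -
  let ?K = "V \<inter> sphere 0 1"
  \<comment> \<open>\<open>sgn y\<close> is y divided by its Euclidean norm; this positive factor
    cancels between \<open>p\<close> and \<open>q\<close>.\<close>
  have scale: "sgn y \<in> ?K" "p (sgn y) / q (sgn y) = p y / q y" if "y \<in> V - {0}" for y
    using that assms(1) by (auto simp: sgn_div_norm assms(5,6) subspace_scale)
  obtain v where "v \<in> V - {0}"
    using assms(1,2) subspace_0 by blast
  with scale have ne: "?K \<noteq> {}"
    by blast
  have cpt: "compact ?K"
    using closed_subspace[OF assms(1)] by (simp add: closed_Int_compact)
  have "q x \<noteq> 0" if "x \<in> ?K" for x
    using that assms(7)[of x] by force
  then have cont: "continuous_on ?K (\<lambda>x. p x / q x)"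
    using assms(3,4) by (intro continuous_on_divide) (auto intro: continuous_on_subset)
  have sub: "?K \<subseteq> V - {0}"
    by auto
  show "\<exists>x\<in>V - {0}. \<forall>y\<in>V - {0}. p x / q x \<le> p y / q y"
    using continuous_attains_inf[OF cpt ne cont] scale sub by (metis subsetD)
  show "\<exists>x\<in>V - {0}. \<forall>y\<in>V - {0}. p y / q y \<le> p x / q x"
    using continuous_attains_sup[OF cpt ne cont] scale sub by (metis subsetD)
qed

text \<open>Compare at a minimiser z of \<open>g\<close>: c * min f \<le> c * f z \<le> d * g z.
  Having a constant on each side lets the lemma serve for lower and upper bounds alike.\<close>

lemma Least_image_mono:
  fixes f g :: "'b \<Rightarrow> real"
  assumes "\<exists>x\<in>X. \<forall>y\<in>X. f x \<le> f y" "\<exists>x\<in>X. \<forall>y\<in>X. g x \<le> g y"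
    and "0 \<le> c" "0 \<le> d" "\<And>x. x \<in> X \<Longrightarrow> c * f x \<le> d * g x"
  shows "c * (LEAST t. t \<in> {f x | x. x \<in> X}) \<le> d * (LEAST t. t \<in> {g x | x. x \<in> X})"
proof -
  obtain x where x: "x \<in> X" "\<forall>y\<in>X. f x \<le> f y" using assms(1) by blast
  obtain z where z: "z \<in> X" "\<forall>y\<in>X. g z \<le> g y" using assms(2) by blast
  \<comment> \<open>On the reals \<open>LEAST\<close> is only determined when the minimum is
    attained; the minimisers \<open>x\<close> and \<open>z\<close> supply this.\<close>
  have "(LEAST t. t \<in> {f x | x. x \<in> X}) = f x" "(LEAST t. t \<in> {g x | x. x \<in> X}) = g z"
    using x z by (auto intro!: Least_equality)
  moreover have "c * f x \<le> c * f z"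
    using x z assms(3) by (simp add: mult_left_mono)
  ultimately show ?thesis
    using assms(5)[OF z(1)] by simp
qed

text \<open>Dually, the comparison takes place at a maximiser of the smaller side
  \<open>f\<close>.\<close>

lemma Greatest_image_mono:
  fixes f g :: "'b \<Rightarrow> real"
  assumes "\<exists>x\<in>X. \<forall>y\<in>X. f y \<le> f x" "\<exists>x\<in>X. \<forall>y\<in>X. g y \<le> g x"
    and "0 \<le> c" "0 \<le> d" "\<And>x. x \<in> X \<Longrightarrow> c * f x \<le> d * g x"
  shows "c * (GREATEST t. t \<in> {f x | x. x \<in> X}) \<le> d * (GREATEST t. t \<in> {g x | x. x \<in> X})"
proof -
  obtain x where x: "x \<in> X" "\<forall>y\<in>X. f y \<le> f x" using assms(1) by blast
  obtain z where z: "z \<in> X" "\<forall>y\<in>X. g y \<le> g z" using assms(2) by blast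
  have "(GREATEST t. t \<in> {f x | x. x \<in> X}) = f x" "(GREATEST t. t \<in> {g x | x. x \<in> X}) = g z"
    using x z by (auto intro!: Greatest_equality)
  moreover have "d * g x \<le> d * g z"
    using x z assms(4) by (simp add: mult_left_mono)
  ultimately show ?thesis
    using assms(5)[OF x(1)] by simp
qed

theorem proposition3p3:
  fixes R :: "'a::real_or_complex ^ 'n ^ 'n"
    and \<Theta> :: "'a ^ 'n ^ 'k"
    and A :: "'p \<Rightarrow> 'a ^ 'n ^ 'n"
    and b u :: "'p \<Rightarrow> 'a ^ 'n"
    and \<mu> :: 'p
    and Ur :: "('a ^ 'n) set"
    and \<epsilon> :: real
  assumes "hermitian_pos_def R"
    and "CARD('k) \<le> CARD('n)"
    and "A \<mu> *v u \<mu> = b \<mu>"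
    and "vec.subspace Ur"
    and "augmented_space (u \<mu>) Ur \<noteq> {0}"
    and "0 \<le> \<epsilon>" and "\<epsilon> \<le> 1"
    and "subspace_embedding R \<Theta> \<epsilon> (residual_space R (A \<mu>) (b \<mu>) Ur)"
  shows "sqrt (1 - \<epsilon>) * zeta R (A \<mu>) (u \<mu>) Ur \<le> sketched_zeta R \<Theta> (A \<mu>) (u \<mu>) Ur
       \<and> sketched_zeta R \<Theta> (A \<mu>) (u \<mu>) Ur \<le> sqrt (1 + \<epsilon>) * zeta R (A \<mu>) (u \<mu>) Ur
       \<and> sqrt (1 - \<epsilon>) * iota R (A \<mu>) (u \<mu>) Ur \<le> sketched_iota R \<Theta> (A \<mu>) (u \<mu>) Ur
       \<and> sketched_iota R \<Theta> (A \<mu>) (u \<mu>) Ur \<le> sqrt (1 + \<epsilon>) * iota R (A \<mu>) (u \<mu>) Ur"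
proof -
  define W where "W = augmented_space (u \<mu>) Ur"
  let ?B = "\<lambda>x. matrix_inv R *v (A \<mu> *v x)"
  let ?p = "\<lambda>x. norm_U' R (A \<mu> *v x)"
  let ?s = "\<lambda>x. sketched_norm_U' R \<Theta> (A \<mu> *v x)"
  have p: "?p x = norm_U R (?B x)" and s: "?s x = norm (\<Theta> *v ?B x)" for x
    by (simp_all add: norm_U'_eq_norm_U[OF assms(1)] sketched_norm_U'_def)
  have W: "subspace W" "W \<noteq> {0}"
    using subspace_augmented_space[OF assms(4)] assms(5)
    by (auto simp: W_def vec_subspace_imp_subspace)
  have pos: "0 < norm_U R x" if "x \<noteq> 0" for x
    using that by (rule norm_U_pos[OF assms(1)])
  have cont: "continuous_on UNIV ?p" "continuous_on UNIV ?s" "continuous_on UNIV (norm_U R)"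
    unfolding p s by (intro continuous_intros)+
  have homog: "?p (c *\<^sub>R x) = \<bar>c\<bar> * ?p x" "?s (c *\<^sub>R x) = \<bar>c\<bar> * ?s x" for c x
    unfolding p s by (simp_all add: matrix_vector_mult_scaleR_right norm_U_scaleR)
  note ext_p = quotient_attains_extrema[OF W cont(1,3) homog(1) norm_U_scaleR pos]
    and ext_s = quotient_attains_extrema[OF W cont(2,3) homog(2) norm_U_scaleR pos]
  \<comment> \<open>The explicit factor 1 gives both inequalities the shape c * f x \<le> d * g x of
    the comparison lemmas.\<close>
  have bounds: "sqrt (1 - \<epsilon>) * (?p x / norm_U R x) \<le> 1 * (?s x / norm_U R x)"
    "1 * (?s x / norm_U R x) \<le> sqrt (1 + \<epsilon>) * (?p x / norm_U R x)" if "x \<in> W - {0}" for x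
  proof -
    have "?B x \<in> residual_space R (A \<mu>) (b \<mu>) Ur"
      using that assms(3,4) by (simp add: W_def matrix_inv_image_in_residual_space)
    note e = subspace_embedding_norm_bounds[OF assms(1,8) this assms(6,7)]
    show "sqrt (1 - \<epsilon>) * (?p x / norm_U R x) \<le> 1 * (?s x / norm_U R x)"
      "1 * (?s x / norm_U R x) \<le> sqrt (1 + \<epsilon>) * (?p x / norm_U R x)"
      using e pos[of x] that unfolding p s by (simp_all add: divide_right_mono)
  qed
  have nonneg: "0 \<le> sqrt (1 - \<epsilon>)" "0 \<le> sqrt (1 + \<epsilon>)" "0 \<le> (1::real)"
    using assms(6,7) by simp_all
  show ?thesis
    unfolding zeta_def iota_def sketched_zeta_def sketched_iota_def W_def[symmetric]
    \<comment> \<open>For lower bounds the exact quotient is \<open>f\<close> and the sketched one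
      \<open>g\<close>; for upper bounds the roles are exchanged.\<close>
    using Least_image_mono[OF ext_p(1) ext_s(1) nonneg(1,3) bounds(1)]
      Least_image_mono[OF ext_s(1) ext_p(1) nonneg(3,2) bounds(2)]
      Greatest_image_mono[OF ext_p(2) ext_s(2) nonneg(1,3) bounds(1)]
      Greatest_image_mono[OF ext_s(2) ext_p(2) nonneg(3,2) bounds(2)]
    by simp
qed

end
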